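(* The space $\mathcal{A}_{\mathbb{L}}$ is a Banach lattice. The mapping $T\colon\mathcal{A}_{\mathbb{L}}\to\mathcal{C}(2^\omega)$, given for every $(a_s)_{s\in\mathbb{L}}\in\mathcal{A}_{\mathbb{L}}$ by $$T\big((a_s)_{s\in\mathbb{L}}\big)=\sum_{s\in\mathbb{L}}a_s\chi_{[Q(s)]},$$ is a (well-defined) lattice isometry onto $\mathcal{C}(2^\omega)$. Moreover, the homeomorphic embedding $R\colon\mathbb{L}\to2^\omega$ satisfies, for every $s,t\in\mathbb{L}$, $$\tilde\delta_s(\tilde\chi_t)=\big\langle\delta_{R(s)},T(\tilde\chi_t)\big\rangle.$$
   Context: $\omega=\{0,1,2,\dots\}$; $\mathbb{L}=\omega^{<\omega}$ is the set of finite sequences in $\omega$, $\epsilon$ the empty sequence, $l(s)$ the length of $s$, $s\preceq t$ means $s$ is an initial segment of $t$, $s*n$ is $s$ with $n$ appended, $\mathbb{L}_s=\{t\in\mathbb{L}:s\preceq t\}$. For $a=(a_s)_{s\in\mathbb{L}}\in\mathbb{R}^{\mathbb{L}}$ let $\|a\|^{\mathbb{L}}=\sup_{t\in\mathbb{L}}|\sum_{s\preceq t}a_s|$; for $\Omega\subseteq\mathbb{L}$, $a\restriction\Omega$ equals $a$ on $\Omega$ and $0$ elsewhere. $\mathcal{A}_{\mathbb{L}}$ is the space (norm $\|\cdot\|^{\mathbb{L}}$, coordinatewise linear operations) of all $a\in\mathbb{R}^{\mathbb{L}}$ with (A.1) $\|a\|^{\mathbb{L}}<\infty$; (A.2) $\lim_n\|a\restriction\mathbb{L}_{s*n}\|^{\mathbb{L}}=0$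 for each $s\in\mathbb{L}$; (A.3) $\lim_n\|a\restriction\{t\in\mathbb{L}:l(t)\ge n\}\|^{\mathbb{L}}=0$. Order: $a\le b$ iff $\sum_{s\preceq t}a_s\le\sum_{s\preceq t}b_s$ for all $t\in\mathbb{L}$. For $s\in\mathbb{L}$: $\tilde\chi_s\in\mathcal{A}_{\mathbb{L}}$ has coordinate $1$ at $s$ and $0$ elsewhere, and $\tilde\delta_s\big((a_t)_t\big)=\sum_{t\preceq s}a_t$. A trunk is a finite subset of $\mathbb{L}$ containing $\epsilon$ and closed under initial segments. In a Banach space, $\sum_{s\in\mathbb{L}}e_s$ denotes the norm limit of the net $\big(\sum_{s\in F}e_s\big)_F$ indexed by trunks $F$ ordered by inclusion (if it exists). For $s=\langle s_1,\dots,s_n\rangle\in\mathbb{L}$, $Q(s)\in2^{<\omega}$ is the finite sequence: $s_1$ ones, a zero, $s_2$ ones, a zero, …, $s_n$ ones, a zero ($Q(\epsilon)=\epsilon$); $R(s)\in2^\omega$ is $Q(s)$ followed by infinitely many ones. $\mathbb{L}$ carries the topology making the injection $R$ a homeomorphism onto its image. For $u\in2^{<\omega}$, $[u]\subseteq2^\omega$ is the clopen set of all sequences extending $u$; $\chi_A$ is the characteristic function of $A$. $\mathcal{C}(2^\omega)$ is the Banach lattice of continuous real functions with sup norm and pointwise order; $\langle\delta_x,f\rangle=f(x)$. *)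

theory Defs
  imports "HOL-Analysis.Analysis" "HOL-Library.Function_Algebras" "HOL-Library.Sublist"
begin

section \<open>Banach lattices on a carrier set\<close>

text \<open>Coordinatewise scalar multiplication; coordinatewise addition is the one of
  \<^theory>\<open>HOL-Library.Function_Algebras\<close>.\<close>

instantiation "fun" :: (type, real_vector) real_vector
begin

definition scaleR_fun :: "real \<Rightarrow> ('a \<Rightarrow> 'b) \<Rightarrow> 'a \<Rightarrow> 'b"
  where "scaleR_fun c f = (\<lambda>x. c *\<^sub>R f x)"

instance
  by standard (simp_all add: scaleR_fun_def fun_eq_iff scaleR_add_right scaleR_add_left)

end

definition is_sup_on :: "'a set \<Rightarrow> ('a \<Rightarrow> 'a \<Rightarrow> bool) \<Rightarrow> 'a \<Rightarrow> 'a \<Rightarrow> 'a \<Rightarrow> bool"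
  where "is_sup_on V le x y z \<longleftrightarrow>
    z \<in> V \<and> le x z \<and> le y z \<and> (\<forall>w\<in>V. le x w \<longrightarrow> le y w \<longrightarrow> le z w)"

definition is_inf_on :: "'a set \<Rightarrow> ('a \<Rightarrow> 'a \<Rightarrow> bool) \<Rightarrow> 'a \<Rightarrow> 'a \<Rightarrow> 'a \<Rightarrow> bool"
  where "is_inf_on V le x y z \<longleftrightarrow>
    z \<in> V \<and> le z x \<and> le z y \<and> (\<forall>w\<in>V. le w x \<longrightarrow> le w y \<longrightarrow> le w z)"

locale banach_space_on =
  fixes V :: "'a::real_vector set" and N :: "'a \<Rightarrow> real"
  assumes subspace: "subspace V"
    and norm_nonneg: "x \<in> V \<Longrightarrow> 0 \<le> N x"
    and norm_eq_zero: "x \<in> V \<Longrightarrow> N x = 0 \<longleftrightarrow> x = 0"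
    and norm_scale: "x \<in> V \<Longrightarrow> N (c *\<^sub>R x) = \<bar>c\<bar> * N x"
    and norm_triangle: "x \<in> V \<Longrightarrow> y \<in> V \<Longrightarrow> N (x + y) \<le> N x + N y"
    and complete:
      "(\<And>n. \<sigma> n \<in> V) \<Longrightarrow> (\<And>e. 0 < e \<Longrightarrow> \<exists>M. \<forall>m\<ge>M. \<forall>n\<ge>M. N (\<sigma> m - \<sigma> n) < e)
        \<Longrightarrow> \<exists>x\<in>V. (\<lambda>n. N (\<sigma> n - x)) \<longlonglongrightarrow> 0"

text \<open>In \<open>norm_mono\<close>, \<open>u\<close> and \<open>v\<close> are the moduli of \<open>x\<close> and \<open>y\<close>.\<close>

locale banach_lattice_on = banach_space_on V N
  for V :: "'a::real_vector set" and N :: "'a \<Rightarrow> real" +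
  fixes le :: "'a \<Rightarrow> 'a \<Rightarrow> bool"
  assumes le_refl: "x \<in> V \<Longrightarrow> le x x"
    and le_antisym: "x \<in> V \<Longrightarrow> y \<in> V \<Longrightarrow> le x y \<Longrightarrow> le y x \<Longrightarrow> x = y"
    and le_trans: "x \<in> V \<Longrightarrow> y \<in> V \<Longrightarrow> z \<in> V \<Longrightarrow> le x y \<Longrightarrow> le y z \<Longrightarrow> le x z"
    and le_add: "x \<in> V \<Longrightarrow> y \<in> V \<Longrightarrow> z \<in> V \<Longrightarrow> le x y \<Longrightarrow> le (x + z) (y + z)"
    and le_scale: "x \<in> V \<Longrightarrow> y \<in> V \<Longrightarrow> 0 \<le> c \<Longrightarrow> le x y \<Longrightarrow> le (c *\<^sub>R x) (c *\<^sub>R y)"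
    and ex_sup: "x \<in> V \<Longrightarrow> y \<in> V \<Longrightarrow> \<exists>z. is_sup_on V le x y z"
    and ex_inf: "x \<in> V \<Longrightarrow> y \<in> V \<Longrightarrow> \<exists>z. is_inf_on V le x y z"
    and norm_mono: "x \<in> V \<Longrightarrow> y \<in> V \<Longrightarrow> is_sup_on V le x (- x) u \<Longrightarrow> is_sup_on V le y (- y) v
      \<Longrightarrow> le u v \<Longrightarrow> N x \<le> N y"

locale lattice_isometry_onto =
  fixes V :: "'a::real_vector set" and N :: "'a \<Rightarrow> real" and le :: "'a \<Rightarrow> 'a \<Rightarrow> bool"
    and W :: "'b::real_vector set" and N' :: "'b \<Rightarrow> real" and le' :: "'b \<Rightarrow> 'b \<Rightarrow> bool"
    and T :: "'a \<Rightarrow> 'b"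
  assumes map_add: "x \<in> V \<Longrightarrow> y \<in> V \<Longrightarrow> T (x + y) = T x + T y"
    and map_scale: "x \<in> V \<Longrightarrow> T (c *\<^sub>R x) = c *\<^sub>R T x"
    and map_norm: "x \<in> V \<Longrightarrow> N' (T x) = N x"
    and map_sup: "x \<in> V \<Longrightarrow> y \<in> V \<Longrightarrow> is_sup_on V le x y z \<Longrightarrow> is_sup_on W le' (T x) (T y) (T z)"
    and map_inf: "x \<in> V \<Longrightarrow> y \<in> V \<Longrightarrow> is_inf_on V le x y z \<Longrightarrow> is_inf_on W le' (T x) (T y) (T z)"
    and onto: "T ` V = W"


section \<open>The space of families indexed by finite sequences\<close>

text \<open>The evaluation functional at \<open>t\<close>; the norm and the order below are expressed through it.\<close>

definition deltaL :: "nat list \<Rightarrow> (nat list \<Rightarrow> real) \<Rightarrow> real"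
  where "deltaL t a = (\<Sum>s | prefix s t. a s)"

definition chiL :: "nat list \<Rightarrow> nat list \<Rightarrow> real"
  where "chiL s = (\<lambda>t. if t = s then 1 else 0)"

definition restrL :: "(nat list \<Rightarrow> real) \<Rightarrow> nat list set \<Rightarrow> nat list \<Rightarrow> real"
  where "restrL a \<Omega> = (\<lambda>s. if s \<in> \<Omega> then a s else 0)"

text \<open>The norm is defined for every family and may be infinite.\<close>

definition enormL :: "(nat list \<Rightarrow> real) \<Rightarrow> ennreal"
  where "enormL a = (SUP t. ennreal \<bar>deltaL t a\<bar>)"

definition normL :: "(nat list \<Rightarrow> real) \<Rightarrow> real"
  where "normL a = enn2real (enormL a)"

definition leL :: "(nat list \<Rightarrow> real) \<Rightarrow> (nat list \<Rightarrow> real) \<Rightarrow> bool"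
  where "leL a b \<longleftrightarrow> (\<forall>t. deltaL t a \<le> deltaL t b)"

definition AL :: "(nat list \<Rightarrow> real) set"
  where "AL = {a. enormL a < \<infinity>
    \<and> (\<forall>s. (\<lambda>n. enormL (restrL a {t. prefix (s @ [n]) t})) \<longlonglongrightarrow> 0)
    \<and> (\<lambda>n. enormL (restrL a {t. length t \<ge> n})) \<longlonglongrightarrow> 0}"

lemma chiL_in_AL: "chiL s \<in> AL"
proof -
  have fin: "finite {u. prefix u t}" for t :: "nat list"
    by (rule finite_subset[of _ "set (prefixes t)"]) auto
  have bound: "\<bar>deltaL t (chiL s)\<bar> \<le> 1" for t
    by (simp add: deltaL_def chiL_def sum.delta[OF fin])
  have "enormL (chiL s) \<le> 1"
    unfolding enormL_def
    by (rule SUP_least) (use bound in \<open>simp add: ennreal_le_1\<close>)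
  then have 1: "enormL (chiL s) < \<infinity>"
    by (metis ennreal_one_less_top infinity_ennreal_def le_less_trans)
  have zero: "enormL (restrL (chiL s) \<Omega>) = 0" if "s \<notin> \<Omega>" for \<Omega>
  proof -
    have "restrL (chiL s) \<Omega> = (\<lambda>_. 0)"
      using that by (auto simp: restrL_def chiL_def)
    then show ?thesis by (simp add: enormL_def deltaL_def)
  qed
  have 2: "(\<lambda>n. enormL (restrL (chiL s) {t. prefix (r @ [n]) t})) \<longlonglongrightarrow> 0" for r
  proof (rule tendsto_eventually, unfold eventually_sequentially, intro exI allI impI)
    fix n assume n: "Suc (s ! length r) \<le> n"
    have "\<not> prefix (r @ [n]) s"
    proof
      assume "prefix (r @ [n]) s"
      then have "s ! length r = n" by (auto simp: prefix_def)
      with n show False by simp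
    qed
    then show "enormL (restrL (chiL s) {t. prefix (r @ [n]) t}) = 0" by (intro zero) simp
  qed
  have 3: "(\<lambda>n. enormL (restrL (chiL s) {t. length t \<ge> n})) \<longlonglongrightarrow> 0"
    by (rule tendsto_eventually, unfold eventually_sequentially,
        rule exI[of _ "Suc (length s)"]) (auto intro!: zero)
  show ?thesis using 1 2 3 by (simp add: AL_def)
qed


section \<open>Limits along trunks\<close>

definition trunk :: "nat list set \<Rightarrow> bool"
  where "trunk F \<longleftrightarrow> finite F \<and> [] \<in> F \<and> (\<forall>t\<in>F. \<forall>s. prefix s t \<longrightarrow> s \<in> F)"

definition trunks_at_top :: "nat list set filter"
  where "trunks_at_top = (INF F\<in>{F. trunk F}. principal {G. trunk G \<and> F \<subseteq> G})"

lemma eventually_trunks_at_top: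
  "eventually P trunks_at_top \<longleftrightarrow> (\<exists>F. trunk F \<and> (\<forall>G. trunk G \<and> F \<subseteq> G \<longrightarrow> P G))"
  unfolding trunks_at_top_def
proof (subst eventually_INF_base)
  have "trunk {[]}" by (simp add: trunk_def)
  then show "{F. trunk F} \<noteq> {}" by blast
next
  fix F G assume "F \<in> {F. trunk F}" "G \<in> {F. trunk F}"
  then have "trunk (F \<union> G)" by (auto simp: trunk_def)
  then show "\<exists>H\<in>{F. trunk F}. principal {G. trunk G \<and> H \<subseteq> G}
      \<le> inf (principal {G. trunk G \<and> F \<subseteq> G}) (principal {H. trunk H \<and> G \<subseteq> H})"
    by (intro bexI[of _ "F \<union> G"]) auto
qed (auto simp: eventually_principal)

lemma trunks_at_top_neq_bot: "trunks_at_top \<noteq> bot"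
  unfolding trivial_limit_def eventually_trunks_at_top by auto

definition trunk_sums :: "(nat list \<Rightarrow> 'b::real_normed_vector) \<Rightarrow> 'b \<Rightarrow> bool"  (infix "trunk'_sums" 80)
  where "e trunk_sums l \<longleftrightarrow> ((\<lambda>F. \<Sum>s\<in>F. e s) \<longlongrightarrow> l) trunks_at_top"

definition trunk_sum :: "(nat list \<Rightarrow> 'b::real_normed_vector) \<Rightarrow> 'b"
  where "trunk_sum e = (THE l. e trunk_sums l)"


section \<open>The Cantor space and the operator\<close>

text \<open>The set \<open>2 = {0, 1}\<close> is \<^typ>\<open>bool\<close>, with \<^term>\<open>True\<close> for \<open>1\<close>. The type
  \<^typ>\<open>nat \<Rightarrow> bool\<close> carries the product topology and is compact, so its continuous real functions
  form the type \<^typ>\<open>(nat \<Rightarrow> bool) \<Rightarrow>\<^sub>C real\<close> of bounded continuous functions with the sup norm.\<close>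

definition QL :: "nat list \<Rightarrow> bool list"
  where "QL s = concat (map (\<lambda>n. replicate n True @ [False]) s)"

definition RL :: "nat list \<Rightarrow> nat \<Rightarrow> bool"
  where "RL s = (\<lambda>i. if i < length (QL s) then QL s ! i else True)"

definition topL :: "nat list topology"
  where "topL = pullback_topology UNIV RL euclidean"

definition cyl :: "bool list \<Rightarrow> (nat \<Rightarrow> bool) set"
  where "cyl u = {x. \<forall>i<length u. x i = u ! i}"

lemma clopen_cyl: "open (cyl u)" "closed (cyl u)"
proof -
  have eq: "cyl u = (\<Inter>i\<in>{..<length u}. (\<lambda>x. x i) -` {u ! i})"
    by (auto simp: cyl_def)
  have "open ((\<lambda>x::nat \<Rightarrow> bool. x i) -` {b})" for i b
    by (intro open_vimage continuous_on_product_coordinates open_discrete)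
  then show "open (cyl u)" unfolding eq by (intro open_INT) auto
  have "closed ((\<lambda>x::nat \<Rightarrow> bool. x i) -` {b})" for i b
    by (intro closed_vimage continuous_on_product_coordinates) simp
  then show "closed (cyl u)" unfolding eq by (intro closed_INT) auto
qed

definition chi_cyl :: "bool list \<Rightarrow> (nat \<Rightarrow> bool) \<Rightarrow>\<^sub>C real"
  where "chi_cyl u = Bcontfun (indicator (cyl u))"

lemma apply_chi_cyl: "apply_bcontfun (chi_cyl u) = indicator (cyl u)"
proof -
  have "continuous_on (cyl u \<union> - cyl u) (\<lambda>x. if x \<in> cyl u then 1 else 0 :: real)"
    by (rule continuous_on_cases) (auto simp: clopen_cyl)
  then have "continuous_on UNIV (indicator (cyl u) :: _ \<Rightarrow> real)"
    by (simp add: indicator_def of_bool_def)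
  moreover have "bounded (range (indicator (cyl u) :: _ \<Rightarrow> real))"
    by (rule boundedI[of _ 1]) (auto simp: indicator_def)
  ultimately have "indicator (cyl u) \<in> (bcontfun :: ((nat \<Rightarrow> bool) \<Rightarrow> real) set)"
    unfolding bcontfun_def by blast
  then show ?thesis
    unfolding chi_cyl_def by (rule Bcontfun_inverse)
qed

definition leC :: "((nat \<Rightarrow> bool) \<Rightarrow>\<^sub>C real) \<Rightarrow> ((nat \<Rightarrow> bool) \<Rightarrow>\<^sub>C real) \<Rightarrow> bool"
  where "leC f g \<longleftrightarrow> (\<forall>x. apply_bcontfun f x \<le> apply_bcontfun g x)"

definition diracC :: "(nat \<Rightarrow> bool) \<Rightarrow> ((nat \<Rightarrow> bool) \<Rightarrow>\<^sub>C real) \<Rightarrow> real"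
  where "diracC x f = apply_bcontfun f x"

definition TL :: "(nat list \<Rightarrow> real) \<Rightarrow> (nat \<Rightarrow> bool) \<Rightarrow>\<^sub>C real"
  where "TL a = trunk_sum (\<lambda>s. a s *\<^sub>R chi_cyl (QL s))"

end

theory Submission
  imports Defs
begin

text \<open>
  The theorem rests on one description of the space: a family \<open>a\<close> lies in \<^const>\<open>AL\<close> exactly
  when the function \<open>t \<mapsto> deltaL t a\<close> extends, along the embedding \<open>RL\<close>, to a continuous function
  on the Cantor space (\<open>TL_RL\<close> and \<open>extends_mem_AL\<close>). The range of \<open>RL\<close> consists of the sequences
  with finitely many zeros, so it is dense, the extension is unique, and its norm and its order can
  be read off on the range. There they are, by definition, \<^const>\<open>normL\<close> and \<^const>\<open>leL\<close>. Hence
  the map taking \<open>a\<close> to its extension is a linear isometric order isomorphism onto the continuous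
  functions, and every Banach lattice axiom is pulled back along it
  (\<open>banach_lattice_pullback\<close>).

  Three things remain. First, the extension is \<^term>\<open>TL a\<close>: since
  \<open>RL t \<in> cyl (QL s)\<close> holds iff \<open>s\<close> is an initial segment of \<open>t\<close>, a partial sum over a trunk \<open>G\<close>
  takes at \<open>RL t\<close> the value \<^term>\<open>deltaL u a\<close>, where \<open>u\<close> is the longest initial segment of \<open>t\<close>
  in \<open>G\<close>. Membership in \<^const>\<open>AL\<close> provides a trunk beyond which \<open>deltaL u a\<close> is uniformly
  close to \<open>deltaL t a\<close> (\<open>AL_trunk\<close>): the condition on high levels bounds its height, and the
  condition on the cones above the successors of a node cuts it down to finitely many successors
  of each node. So the partial sums form a Cauchy net in the sup norm.

  Second, the restriction of a continuous function to the range of \<open>RL\<close> comes from a member of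
  \<^const>\<open>AL\<close>. Uniform continuity gives the level condition, because sequences sharing an initial
  segment of length \<open>n\<close> have images agreeing on \<open>n\<close> coordinates, and it gives the cone condition,
  because \<open>RL t\<close> for \<open>t\<close> above \<open>s @ [n]\<close> begins with \<open>QL s\<close> and \<open>n\<close> ones, just as \<open>RL s\<close> does.
  Third, the topology \<^const>\<open>topL\<close> is pulled back along \<open>RL\<close>, so that \<open>RL\<close> is an embedding as soon
  as it is injective.
\<close>

section \<open>Pulling back a Banach lattice structure\<close>

lemma is_sup_on_pullback:
  assumes onto: "T ` V = W" and ord: "\<And>x y. x \<in> V \<Longrightarrow> y \<in> V \<Longrightarrow> le x y \<longleftrightarrow> le' (T x) (T y)"
    and "x \<in> V" "y \<in> V" "z \<in> V"
  shows "is_sup_on V le x y z \<longleftrightarrow> is_sup_on W le' (T x) (T y) (T z)"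
  using assms by (auto simp: is_sup_on_def)

lemma is_inf_on_pullback:
  assumes onto: "T ` V = W" and ord: "\<And>x y. x \<in> V \<Longrightarrow> y \<in> V \<Longrightarrow> le x y \<longleftrightarrow> le' (T x) (T y)"
    and "x \<in> V" "y \<in> V" "z \<in> V"
  shows "is_inf_on V le x y z \<longleftrightarrow> is_inf_on W le' (T x) (T y) (T z)"
  using assms by (auto simp: is_inf_on_def)

lemma banach_lattice_pullback:
  fixes V :: "'a::real_vector set" and W :: "'b::real_vector set" and T :: "'a \<Rightarrow> 'b"
  assumes W: "banach_lattice_on W N' le'"
    and sub: "subspace V" and onto: "T ` V = W" and inj: "inj_on T V"
    and add: "\<And>x y. x \<in> V \<Longrightarrow> y \<in> V \<Longrightarrow> T (x + y) = T x + T y"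
    and scale: "\<And>c x. x \<in> V \<Longrightarrow> T (c *\<^sub>R x) = c *\<^sub>R T x"
    and norm: "\<And>x. x \<in> V \<Longrightarrow> N' (T x) = N x"
    and ord: "\<And>x y. x \<in> V \<Longrightarrow> y \<in> V \<Longrightarrow> le x y \<longleftrightarrow> le' (T x) (T y)"
  shows "banach_lattice_on V N le" and "lattice_isometry_onto V N le W N' le' T"
proof -
  interpret W: banach_lattice_on W N' le' by (rule W)
  have TW: "T x \<in> W" if "x \<in> V" for x using onto that by blast
  have V0: "0 \<in> V" and Vadd: "\<And>x y. x \<in> V \<Longrightarrow> y \<in> V \<Longrightarrow> x + y \<in> V"
    and Vscale: "\<And>c x. x \<in> V \<Longrightarrow> c *\<^sub>R x \<in> V"
    and Vneg: "\<And>x. x \<in> V \<Longrightarrow> - x \<in> V" and Vdiff: "\<And>x y. x \<in> V \<Longrightarrow> y \<in> V \<Longrightarrow> x - y \<in> V"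
    using sub by (auto simp: subspace_0 subspace_add subspace_scale subspace_neg subspace_diff)
  have T0: "T 0 = 0" using scale[OF V0, of 0] by simp
  have Tneg: "T (- x) = - T x" if "x \<in> V" for x using scale[OF that, of "-1"] by simp
  have Tdiff: "T (x - y) = T x - T y" if "x \<in> V" "y \<in> V" for x y
    using add[OF that(1) Vneg[OF that(2)]] Tneg[OF that(2)] by simp
  have inj': "x = y" if "T x = T y" "x \<in> V" "y \<in> V" for x y
    using inj that by (auto dest: inj_onD)
  note sup = is_sup_on_pullback[where le=le and le'=le', OF onto ord]
  note inf = is_inf_on_pullback[where le=le and le'=le', OF onto ord]
  have supV: "z \<in> V" if "is_sup_on V le x y z" for x y z using that by (simp add: is_sup_on_def)
  have infV: "z \<in> V" if "is_inf_on V le x y z" for x y z using that by (simp add: is_inf_on_def)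
  show "banach_lattice_on V N le"
  proof
    fix x assume x: "x \<in> V"
    show "0 \<le> N x" using W.norm_nonneg[OF TW[OF x]] norm[OF x] by simp
    show "N x = 0 \<longleftrightarrow> x = 0"
      using W.norm_eq_zero[OF TW[OF x]] norm[OF x] inj'[OF _ x V0] T0 by auto
    show "N (c *\<^sub>R x) = \<bar>c\<bar> * N x" for c
      using W.norm_scale[OF TW[OF x]] norm[OF x] norm[OF Vscale[OF x]] scale[OF x] by simp
    show "le x x" using W.le_refl[OF TW[OF x]] ord[OF x x] by simp
  next
    fix x y assume xy: "x \<in> V" "y \<in> V"
    show "N (x + y) \<le> N x + N y"
      using W.norm_triangle[OF TW TW, OF xy] norm[OF xy(1)] norm[OF xy(2)] norm[OF Vadd[OF xy]]
        add[OF xy] by simp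
    show "x = y" if "le x y" "le y x"
      using that xy by (intro inj' W.le_antisym) (simp_all add: TW ord)
    show "le (c *\<^sub>R x) (c *\<^sub>R y)" if "0 \<le> c" "le x y" for c
      using that xy by (simp add: ord Vscale scale W.le_scale TW)
    obtain w where w: "is_sup_on W le' (T x) (T y) w" using W.ex_sup[OF TW TW, OF xy] by blast
    then obtain z where "z \<in> V" "w = T z" using onto by (auto simp: is_sup_on_def)
    then show "\<exists>z. is_sup_on V le x y z" using w sup[of x y z] xy by auto
    obtain w where w: "is_inf_on W le' (T x) (T y) w" using W.ex_inf[OF TW TW, OF xy] by blast
    then obtain z where "z \<in> V" "w = T z" using onto by (auto simp: is_inf_on_def)
    then show "\<exists>z. is_inf_on V le x y z" using w inf[of x y z] xy by auto
  next
    fix x y z assume xyz: "x \<in> V" "y \<in> V" "z \<in> V"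
    show "le x z" if "le x y" "le y z"
      using that xyz W.le_trans[of "T x" "T y" "T z"] by (simp add: ord TW)
    show "le (x + z) (y + z)" if "le x y"
      using that xyz W.le_add[of "T x" "T y" "T z"] by (simp add: ord TW Vadd add)
  next
    fix x y u v assume xy: "x \<in> V" "y \<in> V"
      and uv: "is_sup_on V le x (- x) u" "is_sup_on V le y (- y) v" "le u v"
    have uvV: "u \<in> V" "v \<in> V" using uv supV by auto
    have "is_sup_on W le' (T x) (- T x) (T u)" "is_sup_on W le' (T y) (- T y) (T v)"
      using uv xy uvV sup[of x "- x" u] sup[of y "- y" v] by (auto simp: Vneg Tneg)
    moreover have "le' (T u) (T v)" using uv uvV ord by blast
    ultimately have "N' (T x) \<le> N' (T y)" using W.norm_mono TW xy by blast
    then show "N x \<le> N y" using norm xy by simp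
  next
    fix \<sigma> :: "nat \<Rightarrow> 'a"
    assume \<sigma>: "\<And>n. \<sigma> n \<in> V" and C: "\<And>e. 0 < e \<Longrightarrow> \<exists>M. \<forall>m\<ge>M. \<forall>n\<ge>M. N (\<sigma> m - \<sigma> n) < e"
    have dist: "N' (T x - T y) = N (x - y)" if "x \<in> V" "y \<in> V" for x y
      using norm[OF Vdiff[OF that]] Tdiff[OF that] by simp
    have "\<exists>w\<in>W. (\<lambda>n. N' (T (\<sigma> n) - w)) \<longlonglongrightarrow> 0"
      by (rule W.complete) (use \<sigma> C in \<open>auto simp: TW dist\<close>)
    then obtain x where x: "x \<in> V" "(\<lambda>n. N' (T (\<sigma> n) - T x)) \<longlonglongrightarrow> 0" using onto by blast
    then show "\<exists>x\<in>V. (\<lambda>n. N (\<sigma> n - x)) \<longlonglongrightarrow> 0" using \<sigma> by (auto simp: dist)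
  qed (rule sub)
  show "lattice_isometry_onto V N le W N' le' T"
  proof
    show "is_sup_on W le' (T x) (T y) (T z)" if "x \<in> V" "y \<in> V" "is_sup_on V le x y z" for x y z
      using that sup[of x y z] supV[OF that(3)] by simp
    show "is_inf_on W le' (T x) (T y) (T z)" if "x \<in> V" "y \<in> V" "is_inf_on V le x y z" for x y z
      using that inf[of x y z] infV[OF that(3)] by simp
  qed (simp_all add: add scale norm onto)
qed


section \<open>Continuous functions on the Cantor space\<close>

text \<open>A Cauchy sequence converges uniformly, and a uniform limit of continuous functions is
  continuous on any topological space, in particular on a product such as the Cantor space.\<close>

lemma complete_bcontfun: "complete (UNIV :: ('a::topological_space \<Rightarrow>\<^sub>C 'b::complete_space) set)"
  unfolding complete_def
proof safe
  fix f :: "nat \<Rightarrow> 'a \<Rightarrow>\<^sub>C 'b"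
  assume "Cauchy f"
  have "\<exists>N. \<forall>m n x. N \<le> m \<and> N \<le> n \<and> True \<longrightarrow> dist (f m x) (f n x) < e" if "0 < e" for e
    using metric_CauchyD[OF \<open>Cauchy f\<close> that] by (meson dist_fun_lt_imp_dist_val_lt)
  then obtain g where "\<forall>e>0. \<exists>N. \<forall>n x. N \<le> n \<and> True \<longrightarrow> dist (f n x) (g x) < e"
    using uniformly_convergent_eq_cauchy[of "\<lambda>_. True" f] by auto
  then have "uniform_limit UNIV f g sequentially"
    unfolding uniform_limit_sequentially_iff by simp
  from uniform_limit_bcontfunE[OF this sequentially_bot]
  obtain l where "g = apply_bcontfun l" "f \<longlonglongrightarrow> l" by metis
  then show "\<exists>l\<in>UNIV. f \<longlonglongrightarrow> l" by auto
qed

lemma ex_bcontfun_max: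
  fixes f g :: "'a::topological_space \<Rightarrow>\<^sub>C real"
  shows "\<exists>h :: 'a \<Rightarrow>\<^sub>C real. \<forall>x. h x = max (f x) (g x)"
proof -
  have "(\<lambda>x. max (f x) (g x)) \<in> bcontfun"
  proof (rule bcontfun_normI)
    show "continuous_on UNIV (\<lambda>x. max (f x) (g x))" by (intro continuous_intros) auto
    show "norm (max (f x) (g x)) \<le> norm f + norm g" for x
      using norm_bounded[of f x] norm_bounded[of g x] by auto
  qed
  then show ?thesis by (metis bcontfunE)
qed

text \<open>The pointwise maximum is continuous, so it competes with any order supremum and must equal
  it.\<close>

lemma is_sup_on_leC: "is_sup_on UNIV leC f g h \<longleftrightarrow> (\<forall>x. h x = max (f x) (g x))"
proof
  obtain k where k: "\<forall>x. apply_bcontfun k x = max (f x) (g x)" using ex_bcontfun_max by blast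
  assume "is_sup_on UNIV leC f g h"
  moreover have "leC f k" "leC g k" using k by (simp_all add: leC_def)
  ultimately have "leC f h" "leC g h" "leC h k" by (simp_all add: is_sup_on_def)
  then have "f x \<le> h x" "g x \<le> h x" "h x \<le> max (f x) (g x)" for x
    using k by (auto simp only: leC_def)
  then show "\<forall>x. h x = max (f x) (g x)" by (intro allI antisym) auto
qed (simp add: is_sup_on_def leC_def)

lemma ex_sup_leC: "\<exists>h. is_sup_on UNIV leC f g h"
  using ex_bcontfun_max[of f g] by (simp add: is_sup_on_leC)

lemma is_inf_on_leC_uminus:
  "is_sup_on UNIV leC (- f) (- g) h \<Longrightarrow> is_inf_on UNIV leC f g (- h)"
proof -
  assume "is_sup_on UNIV leC (- f) (- g) h"
  then have "(- h) x = min (f x) (g x)" for x by (simp add: is_sup_on_leC min_def)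
  then show "is_inf_on UNIV leC f g (- h)"
    by (simp add: is_inf_on_def leC_def del: uminus_bcontfun.rep_eq)
qed

lemma banach_lattice_C: "banach_lattice_on UNIV norm leC"
proof
  show "subspace (UNIV :: ((nat \<Rightarrow> bool) \<Rightarrow>\<^sub>C real) set)" by (rule subspace_UNIV)
next
  fix \<sigma> :: "nat \<Rightarrow> (nat \<Rightarrow> bool) \<Rightarrow>\<^sub>C real"
  assume "\<And>e. 0 < e \<Longrightarrow> \<exists>M. \<forall>m\<ge>M. \<forall>n\<ge>M. norm (\<sigma> m - \<sigma> n) < e"
  then have "Cauchy \<sigma>" by (simp add: Cauchy_def dist_norm)
  then obtain l where "\<sigma> \<longlonglongrightarrow> l" using complete_bcontfun unfolding complete_def by blast
  then show "\<exists>x\<in>UNIV. (\<lambda>n. norm (\<sigma> n - x)) \<longlonglongrightarrow> 0"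
    by (auto simp: tendsto_norm_zero_iff LIM_zero_iff)
next
  fix f g :: "(nat \<Rightarrow> bool) \<Rightarrow>\<^sub>C real"
  show "leC f g \<Longrightarrow> leC g f \<Longrightarrow> f = g" by (auto simp: leC_def intro!: bcontfun_eqI antisym)
  show "leC f g \<Longrightarrow> leC g h \<Longrightarrow> leC f h" for h by (meson leC_def order_trans)
  show "\<exists>h. is_sup_on UNIV leC f g h" by (rule ex_sup_leC)
  show "\<exists>h. is_inf_on UNIV leC f g h"
    using ex_sup_leC[of "- f" "- g"] is_inf_on_leC_uminus by blast
next
  fix f g u v :: "(nat \<Rightarrow> bool) \<Rightarrow>\<^sub>C real"
  assume "is_sup_on UNIV leC f (- f) u" "is_sup_on UNIV leC g (- g) v" "leC u v"
  moreover have "max r (- r) = \<bar>r\<bar>" for r :: real by (simp add: max_def abs_real_def)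
  ultimately have le: "\<bar>f x\<bar> \<le> \<bar>g x\<bar>" for x by (simp add: is_sup_on_leC leC_def)
  show "norm f \<le> norm g"
  proof (rule norm_bound)
    show "norm (f x) \<le> norm g" for x using le[of x] norm_bounded[of g x] by simp
  qed
next
  fix f g h :: "(nat \<Rightarrow> bool) \<Rightarrow>\<^sub>C real" and c :: real
  show "0 \<le> norm f" "norm f = 0 \<longleftrightarrow> f = 0" "norm (c *\<^sub>R f) = \<bar>c\<bar> * norm f" by simp_all
  show "norm (f + g) \<le> norm f + norm g" by (rule norm_triangle_ineq)
  show "leC f f" by (simp add: leC_def)
  show "leC (f + h) (g + h)" if "leC f g" using that by (simp add: leC_def)
  show "leC (c *\<^sub>R f) (c *\<^sub>R g)" if "0 \<le> c" "leC f g"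
    using that by (simp add: leC_def mult_left_mono)
qed

lemma compact_Cantor: "compact (UNIV :: (nat \<Rightarrow> bool) set)"
proof -
  have "compact_space (euclidean :: bool topology)"
    by (simp add: compact_space_def finite_imp_compact)
  then have "compact_space (product_topology (\<lambda>i::nat. euclidean :: bool topology) UNIV)"
    by (simp add: compact_space_product_topology)
  then show ?thesis by (simp add: euclidean_product_topology compact_space_def)
qed

lemma Cantor_open_agree:
  assumes "open U" "x \<in> U"
  shows "\<exists>N::nat. \<forall>y::nat \<Rightarrow> bool. (\<forall>i<N. y i = x i) \<longrightarrow> y \<in> U"
proof -
  have "openin (product_topology (\<lambda>i. euclidean) UNIV) U" using assms(1) by (simp add: open_fun_def)
  then obtain X where X: "finite {i. X i \<noteq> (UNIV :: bool set)}" "x \<in> Pi\<^sub>E UNIV X" "Pi\<^sub>E UNIV X \<subseteq> U"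
    using assms(2) unfolding openin_product_topology_alt by auto
  obtain N where N: "\<forall>i\<in>{i. X i \<noteq> UNIV}. i < N"
    using X(1) finite_nat_set_iff_bounded by blast
  have "y \<in> U" if "\<forall>i<N. y i = x i" for y
  proof -
    have "y i \<in> X i" for i
      using X(2) N that by (cases "X i = UNIV") (auto simp: PiE_iff)
    then show ?thesis using X(3) by (auto simp: PiE_iff)
  qed
  then show ?thesis by blast
qed

text \<open>Uniform continuity with respect to the cylinder uniformity, by compactness.\<close>

lemma Cantor_uniformly_continuous:
  fixes f :: "(nat \<Rightarrow> bool) \<Rightarrow>\<^sub>C real"
  assumes "0 < e"
  shows "\<exists>N. \<forall>x y. (\<forall>i<N. x i = y i) \<longrightarrow> \<bar>f x - f y\<bar> < e"
proof -
  have "\<exists>N. \<forall>y. (\<forall>i<N. y i = x i) \<longrightarrow> \<bar>f y - f x\<bar> < e / 2" for x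
  proof -
    have "open (f -` ball (f x) (e / 2))"
      by (intro open_vimage) auto
    from Cantor_open_agree[OF this, of x] show ?thesis
      using assms by (simp add: dist_real_def abs_minus_commute)
  qed
  then obtain M where M: "\<And>x y. (\<forall>i<M x. y i = x i) \<Longrightarrow> \<bar>f y - f x\<bar> < e / 2" by metis
  define U where "U x = cyl (map x [0..<M x])" for x
  have U: "y \<in> U x \<longleftrightarrow> (\<forall>i<M x. y i = x i)" for x y by (simp add: U_def cyl_def)
  obtain X where X: "finite X" "UNIV \<subseteq> (\<Union>x\<in>X. U x)"
  proof (rule compactE_image[OF compact_Cantor, of UNIV U])
    show "open (U x)" for x by (simp add: U_def clopen_cyl)
    show "UNIV \<subseteq> (\<Union>x\<in>UNIV. U x)" using U by blast
  qed
  obtain N where N: "\<forall>x\<in>X. M x \<le> N"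
    using finite_imageI[OF X(1), of M] by (auto simp: finite_nat_set_iff_bounded_le)
  have "\<bar>f x - f y\<bar> < e" if "\<forall>i<N. x i = y i" for x y
  proof -
    obtain z where z: "z \<in> X" "x \<in> U z" using X by blast
    then have x: "\<forall>i<M z. x i = z i" by (simp only: U)
    have y: "\<forall>i<M z. y i = z i"
    proof (intro allI impI)
      fix i assume i: "i < M z"
      then have "i < N" using N z(1) less_le_trans by blast
      with i x that show "y i = z i" by blast
    qed
    show ?thesis using M[OF x] M[OF y] by linarith
  qed
  then show ?thesis by blast
qed


section \<open>The embedding of the tree\<close>

lemma QL_simps:
  "QL [] = []" "QL (n # s) = replicate n True @ False # QL s"
  "QL (s @ [n]) = QL s @ replicate n True @ [False]"
  by (simp_all add: QL_def)

lemma length_le_QL: "length s \<le> length (QL s)"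
  by (induction s) (auto simp: QL_simps)

lemma RL_Nil: "RL [] i" by (simp add: RL_def QL_simps)

lemma RL_Cons: "RL (n # s) i \<longleftrightarrow> (if i < n then True else if i = n then False else RL s (i - Suc n))"
proof -
  consider "i < n" | "i = n" | j where "i = Suc (n + j)"
    using less_imp_Suc_add[of n i] by (cases i n rule: linorder_cases) auto
  then show ?thesis by cases (simp_all add: RL_def QL_simps nth_append)
qed

lemma cyl_QL_Cons: "x \<in> cyl (QL (n # s)) \<longleftrightarrow>
    (\<forall>i<n. x i) \<and> \<not> x n \<and> (\<lambda>i. x (i + Suc n)) \<in> cyl (QL s)"
proof -
  have split: "(\<forall>i<m + k. P i) \<longleftrightarrow> (\<forall>i<m. P i) \<and> (\<forall>i<k. P (i + m))" for m k :: nat and P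
  proof (intro iffI conjI allI impI)
    fix i assume "(\<forall>i<m. P i) \<and> (\<forall>i<k. P (i + m))" "i < m + k"
    then show "P i" by (cases "i < m") (auto dest!: spec[of _ "i - m"])
  qed auto
  have "x \<in> cyl (u @ v) \<longleftrightarrow> x \<in> cyl u \<and> (\<lambda>i. x (i + length u)) \<in> cyl v" for x u v
    by (simp add: cyl_def split nth_append)
  from this[of x "replicate n True @ [False]" "QL s"] show ?thesis
    by (auto simp: QL_simps cyl_def nth_append less_Suc_eq)
qed

text \<open>\<^term>\<open>QL s\<close> ends with a zero, while \<^term>\<open>RL t\<close> has no zeros beyond \<^term>\<open>QL t\<close>.\<close>

lemma RL_in_cyl_QL: "RL t \<in> cyl (QL s) \<longleftrightarrow> prefix s t"
proof (induction s arbitrary: t)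
  case Nil
  then show ?case by (simp add: QL_simps cyl_def)
next
  case (Cons n s)
  show ?case
  proof (cases t)
    case Nil
    then show ?thesis by (simp add: cyl_QL_Cons RL_Nil)
  next
    case t: (Cons m t')
    have "(\<forall>i<n. RL t i) \<and> \<not> RL t n \<longleftrightarrow> n = m"
      using linorder_neqE_nat[of n m] by (auto simp: t RL_Cons)
    moreover have "(\<lambda>i. RL (n # t') (i + Suc n)) = RL t'"
      by (auto simp: RL_Cons)
    ultimately show ?thesis
      using Cons.IH[of t'] by (auto simp: cyl_QL_Cons t)
  qed
qed

lemma inj_RL: "inj RL"
  by (rule injI) (metis RL_in_cyl_QL prefix_order.antisym prefix_order.refl)

lemma embedding_RL: "embedding_map topL euclidean RL"
proof -
  have top: "topspace topL = UNIV" by (simp add: topL_def topspace_pullback_topology)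
  have op: "openin topL S \<longleftrightarrow> (\<exists>U. open U \<and> S = RL -` U)" for S
    by (simp add: topL_def openin_pullback_topology)
  have "homeomorphic_map topL (subtopology euclidean (range RL)) RL"
  proof (rule bijective_open_imp_homeomorphic_map)
    show "continuous_map topL (subtopology euclidean (range RL)) RL"
      unfolding continuous_map_in_subtopology by (auto simp: continuous_map_def top op vimage_def)
    show "open_map topL (subtopology euclidean (range RL)) RL"
      unfolding open_map_def op by (auto simp: openin_subtopology)
  qed (use inj_RL in \<open>auto simp: top\<close>)
  then show ?thesis by (simp add: embedding_map_def top)
qed

lemma RL_agree:
  assumes "prefix s t" "i < length (QL s)"
  shows "RL t i = RL s i"
  using RL_in_cyl_QL[of t s] RL_in_cyl_QL[of s s] assms by (auto simp: cyl_def)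

text \<open>Above \<^term>\<open>s @ [n]\<close> the next \<open>n\<close> coordinates are ones, as they are in \<^term>\<open>RL s\<close>.\<close>

lemma RL_agree_snoc:
  assumes "prefix (s @ [n]) t" "i < n"
  shows "RL t i = RL s i"
proof -
  have "RL t i = RL (s @ [n]) i"
    using assms by (intro RL_agree) (auto simp: QL_simps)
  also have "\<dots> = RL s i"
    using assms by (auto simp: RL_def QL_simps nth_append)
  finally show ?thesis .
qed

text \<open>Density of the range. The coordinates are matched one after another: a one by the tail of
  ones, and a zero by closing a block. Keeping \<^term>\<open>QL t\<close> no longer than the part already
  matched guarantees that the next coordinate still lies in the tail.\<close>

lemma ex_RL_agree: "\<exists>t. \<forall>i<N. RL t i = x i"
proof -
  have "\<exists>t. length (QL t) \<le> N \<and> (\<forall>i<N. RL t i = x i)"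
  proof (induction N)
    case 0
    then show ?case by (auto intro!: exI[of _ "[]"] simp: QL_simps)
  next
    case (Suc N)
    then obtain t where t: "length (QL t) \<le> N" "\<forall>i<N. RL t i = x i" by blast
    show ?case
    proof (cases "x N")
      case True
      moreover have "RL t N" using t(1) by (simp add: RL_def)
      ultimately show ?thesis using t by (auto intro!: exI[of _ t] simp: less_Suc_eq)
    next
      case False
      have "RL (t @ [N - length (QL t)]) i = x i" if "i < Suc N" for i
        using t(2)[rule_format, of i] t(1) that False
        by (cases "i = N") (auto simp: RL_def QL_simps nth_append less_Suc_eq split: if_splits)
      moreover have "length (QL (t @ [N - length (QL t)])) \<le> Suc N" using t by (simp add: QL_simps)
      ultimately show ?thesis by blast
    qed
  qed
  then show ?thesis by blast
qed

lemma closure_range_RL: "closure (range RL) = UNIV"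
proof -
  have "x \<in> closure (range RL)" for x
    unfolding closure_iff_nhds_not_empty
  proof safe
    fix A U assume U: "U \<subseteq> A" "open U" "x \<in> U" and A: "range RL \<inter> A = {}"
    obtain N where N: "\<And>y. (\<forall>i<N. y i = x i) \<Longrightarrow> y \<in> U"
      using Cantor_open_agree[OF U(2,3)] by blast
    obtain t where "\<forall>i<N. RL t i = x i" using ex_RL_agree by blast
    then have "RL t \<in> U" by (rule N)
    with U(1) A show False by blast
  qed
  then show ?thesis by blast
qed

text \<open>By density, pointwise inequalities, and with them the order, equality and the norm, are
  decided on the range of \<open>RL\<close>.\<close>

lemma bcontfun_le_on_RL:
  fixes f g :: "(nat \<Rightarrow> bool) \<Rightarrow>\<^sub>C real"
  assumes "\<And>t. f (RL t) \<le> g (RL t)"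
  shows "f x \<le> g x"
proof -
  have "closed {x. f x \<le> g x}" by (intro closed_Collect_le) auto
  moreover have "range RL \<subseteq> {x. f x \<le> g x}" using assms by auto
  ultimately have "closure (range RL) \<subseteq> {x. f x \<le> g x}" by (rule closure_minimal[rotated])
  then show ?thesis by (auto simp: closure_range_RL)
qed

lemma bcontfun_eq_on_RL: "(\<And>t. apply_bcontfun f (RL t) = apply_bcontfun g (RL t)) \<Longrightarrow> f = (g :: _ \<Rightarrow>\<^sub>C real)"
  by (rule bcontfun_eqI, rule antisym; rule bcontfun_le_on_RL; simp)

lemma norm_le_on_RL:
  fixes f :: "(nat \<Rightarrow> bool) \<Rightarrow>\<^sub>C real"
  assumes "\<And>t. \<bar>f (RL t)\<bar> \<le> B"
  shows "norm f \<le> B"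
proof (rule norm_bound)
  fix x
  have on_RL: "- B \<le> f (RL t)" "f (RL t) \<le> B" for t using assms[of t] by linarith+
  have "const_bcontfun (- B) x \<le> f x" "f x \<le> const_bcontfun B x"
    by (rule bcontfun_le_on_RL, simp add: on_RL)+
  then show "norm (f x) \<le> B" by simp
qed


section \<open>Evaluation functionals\<close>

lemma finite_prefixes: "finite {s. prefix s t}"
  by (rule finite_subset[of _ "set (prefixes t)"]) auto

lemma deltaL_add: "deltaL t (a + b) = deltaL t a + deltaL t b"
  by (simp add: deltaL_def sum.distrib)

lemma deltaL_scale: "deltaL t (c *\<^sub>R a) = c * deltaL t a"
  by (simp add: deltaL_def sum_distrib_left scaleR_fun_def)

lemma deltaL_Nil: "deltaL [] a = a []"
  by (simp add: deltaL_def)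

lemma deltaL_snoc: "deltaL (s @ [n]) a = deltaL s a + a (s @ [n])"
proof -
  have "{u. prefix u (s @ [n])} = insert (s @ [n]) {u. prefix u s}" by auto
  moreover have "\<not> prefix (s @ [n]) s" by (auto dest: prefix_length_le)
  ultimately show ?thesis by (simp add: deltaL_def finite_prefixes)
qed

lemma deltaL_inject: "(\<And>t. deltaL t a = deltaL t b) \<Longrightarrow> a = b"
proof
  fix s assume eq: "\<And>t. deltaL t a = deltaL t b"
  show "a s = b s"
  proof (cases s rule: rev_exhaust)
    case Nil
    then show ?thesis using eq[of "[]"] by (simp add: deltaL_Nil)
  next
    case (snoc u n)
    then show ?thesis using eq[of s] eq[of u] by (simp add: deltaL_snoc)
  qed
qed

text \<open>Every function on the tree is the function of evaluations of a family, namely of its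
  increments.\<close>

lemma ex_deltaL: "\<exists>a. \<forall>t. deltaL t a = g t"
proof (intro exI allI)
  fix t
  show "deltaL t (\<lambda>s. if s = [] then g [] else g s - g (butlast s)) = g t"
    by (induction t rule: rev_induct) (auto simp: deltaL_Nil deltaL_snoc)
qed

lemma deltaL_restr: "deltaL t (restrL a \<Omega>) = sum a {s. prefix s t \<and> s \<in> \<Omega>}"
  using sum.inter_filter[OF finite_prefixes[of t], of a "\<lambda>s. s \<in> \<Omega>"]
  by (simp add: deltaL_def restrL_def)

lemma deltaL_restr_above:
  assumes "prefix s t" "\<And>u. prefix u t \<Longrightarrow> u \<in> \<Omega> \<longleftrightarrow> \<not> prefix u s"
  shows "deltaL t (restrL a \<Omega>) = deltaL t a - deltaL s a"
proof -
  have sub: "{u. prefix u s} \<subseteq> {u. prefix u t}" using assms(1) by (auto intro: prefix_order.trans)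
  have "{u. prefix u t \<and> u \<in> \<Omega>} = {u. prefix u t} - {u. prefix u s}"
    using assms(2) by auto
  then show ?thesis
    unfolding deltaL_restr by (simp add: deltaL_def sum_diff finite_prefixes sub)
qed

lemma deltaL_restr_cone:
  "deltaL t (restrL a {u. prefix (s @ [n]) u}) =
    (if prefix (s @ [n]) t then deltaL t a - deltaL s a else 0)"
proof (cases "prefix (s @ [n]) t")
  case True
  have "prefix (s @ [n]) u \<longleftrightarrow> \<not> prefix u s" if "prefix u t" for u
  proof
    show "prefix (s @ [n]) u \<Longrightarrow> \<not> prefix u s" by (auto dest!: prefix_length_le)
    show "\<not> prefix u s \<Longrightarrow> prefix (s @ [n]) u"
      using prefix_same_cases[OF that True] by (auto simp: prefix_snoc)
  qed
  moreover have "prefix s t" using True by (rule append_prefixD)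
  ultimately show ?thesis using True by (simp add: deltaL_restr_above)
next
  case False
  then show ?thesis
    by (auto simp: deltaL_def restrL_def intro!: sum.neutral dest: prefix_order.trans)
qed

lemma deltaL_restr_level:
  "deltaL t (restrL a {u. length u \<ge> Suc n}) = deltaL t a - deltaL (take n t) a"
proof (rule deltaL_restr_above)
  fix u assume u: "prefix u t"
  then have "prefix u (take n t) \<longleftrightarrow> length u \<le> n"
    using prefix_length_le[of u "take n t"] by (auto simp: prefix_def)
  then show "u \<in> {u. Suc n \<le> length u} \<longleftrightarrow> \<not> prefix u (take n t)" by auto
qed (rule take_is_prefix)


section \<open>The norm and the membership conditions\<close>

lemma enormL_le_iff: "0 \<le> B \<Longrightarrow> enormL a \<le> ennreal B \<longleftrightarrow> (\<forall>t. \<bar>deltaL t a\<bar> \<le> B)"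
  by (simp add: enormL_def SUP_le_iff)

lemma enormL_finite_iff: "enormL a < \<infinity> \<longleftrightarrow> (\<exists>B. \<forall>t. \<bar>deltaL t a\<bar> \<le> B)"
proof
  assume "enormL a < \<infinity>"
  then have "enormL a = ennreal (enn2real (enormL a))" by simp
  then have "\<forall>t. \<bar>deltaL t a\<bar> \<le> enn2real (enormL a)"
    by (metis enormL_le_iff enn2real_nonneg order_refl)
  then show "\<exists>B. \<forall>t. \<bar>deltaL t a\<bar> \<le> B" ..
next
  assume "\<exists>B. \<forall>t. \<bar>deltaL t a\<bar> \<le> B"
  then obtain B where B: "\<forall>t. \<bar>deltaL t a\<bar> \<le> B" ..
  then have "0 \<le> B" using abs_ge_zero order_trans by blast
  with B have "enormL a \<le> ennreal B" by (simp add: enormL_le_iff)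
  then show "enormL a < \<infinity>" using ennreal_less_top by (metis infinity_ennreal_def le_less_trans)
qed

lemma normL_le_iff:
  assumes "enormL a < \<infinity>" "0 \<le> B"
  shows "normL a \<le> B \<longleftrightarrow> (\<forall>t. \<bar>deltaL t a\<bar> \<le> B)"
proof -
  have "enormL a = ennreal (normL a)" using assms(1) by (simp add: normL_def)
  moreover have "ennreal (normL a) \<le> ennreal B \<longleftrightarrow> normL a \<le> B"
    using assms(2) by (simp add: ennreal_le_iff)
  ultimately show ?thesis using enormL_le_iff[OF assms(2), of a] by simp
qed

lemma enormL_tendsto_0_iff:
  "(\<lambda>n. enormL (b n)) \<longlonglongrightarrow> 0 \<longleftrightarrow> (\<forall>e>0. \<exists>M. \<forall>n\<ge>M. \<forall>t. \<bar>deltaL t (b n)\<bar> \<le> e)"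
proof
  assume lim: "(\<lambda>n. enormL (b n)) \<longlonglongrightarrow> 0"
  show "\<forall>e>0. \<exists>M. \<forall>n\<ge>M. \<forall>t. \<bar>deltaL t (b n)\<bar> \<le> e"
  proof (intro allI impI)
    fix e :: real assume "0 < e"
    then have "\<forall>\<^sub>F n in sequentially. enormL (b n) < ennreal e"
      using order_tendstoD(2)[OF lim, of "ennreal e"] by simp
    then obtain M where M: "\<forall>n\<ge>M. enormL (b n) < ennreal e" by (auto simp: eventually_sequentially)
    have "\<forall>t. \<bar>deltaL t (b n)\<bar> \<le> e" if "n \<ge> M" for n
      using M that \<open>0 < e\<close> enormL_le_iff[of e "b n"] by (simp add: less_imp_le)
    then show "\<exists>M. \<forall>n\<ge>M. \<forall>t. \<bar>deltaL t (b n)\<bar> \<le> e" by blast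
  qed
next
  assume R: "\<forall>e>0. \<exists>M. \<forall>n\<ge>M. \<forall>t. \<bar>deltaL t (b n)\<bar> \<le> e"
  show "(\<lambda>n. enormL (b n)) \<longlonglongrightarrow> 0"
  proof (rule order_tendstoI)
    fix y :: ennreal assume "0 < y"
    then obtain e where e: "0 < e" "ennreal e < y"
      by (metis dense ennreal_cases ennreal_less_zero_iff less_top neq_top_trans order_less_imp_not_eq2 top.extremum_strict)
    then obtain M where "\<forall>n\<ge>M. \<forall>t. \<bar>deltaL t (b n)\<bar> \<le> e" using R by blast
    then have "enormL (b n) < y" if "n \<ge> M" for n
      using that e enormL_le_iff[of e "b n"] by (auto intro: le_less_trans)
    then show "\<forall>\<^sub>F n in sequentially. enormL (b n) < y" by (auto simp: eventually_sequentially)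
  qed simp
qed

text \<open>The defining conditions in terms of the function \<open>t \<mapsto> deltaL t a\<close>: a restriction to a cone
  or to high levels turns evaluations into increments.\<close>

lemma mem_AL_iff: "a \<in> AL \<longleftrightarrow>
    (\<exists>B. \<forall>t. \<bar>deltaL t a\<bar> \<le> B) \<and>
    (\<forall>s. \<forall>e>0. \<exists>M. \<forall>n\<ge>M. \<forall>t. prefix (s @ [n]) t \<longrightarrow> \<bar>deltaL t a - deltaL s a\<bar> \<le> e) \<and>
    (\<forall>e>0. \<exists>M. \<forall>n\<ge>M. \<forall>t. \<bar>deltaL t a - deltaL (take n t) a\<bar> \<le> e)"
proof -
  \<comment> \<open>Restricting to lengths above \<open>n\<close> subtracts the value at \<open>take n t\<close>, hence the index shift.\<close>
  have "(\<lambda>n. enormL (restrL a {t. length t \<ge> n})) \<longlonglongrightarrow> 0 \<longleftrightarrow>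
      (\<lambda>n. enormL (restrL a {t. length t \<ge> Suc n})) \<longlonglongrightarrow> 0"
    by (rule filterlim_sequentially_Suc[symmetric])
  also have "\<dots> \<longleftrightarrow> (\<forall>e>0. \<exists>M. \<forall>n\<ge>M. \<forall>t. \<bar>deltaL t a - deltaL (take n t) a\<bar> \<le> e)"
    unfolding enormL_tendsto_0_iff deltaL_restr_level ..
  finally have 3: "(\<lambda>n. enormL (restrL a {t. length t \<ge> n})) \<longlonglongrightarrow> 0 \<longleftrightarrow> \<dots>" .
  have "(\<lambda>n. enormL (restrL a {t. prefix (s @ [n]) t})) \<longlonglongrightarrow> 0 \<longleftrightarrow>
      (\<forall>e>0. \<exists>M. \<forall>n\<ge>M. \<forall>t. prefix (s @ [n]) t \<longrightarrow> \<bar>deltaL t a - deltaL s a\<bar> \<le> e)" for s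
    unfolding enormL_tendsto_0_iff deltaL_restr_cone by (auto split: if_splits)
  with 3 show ?thesis unfolding AL_def mem_Collect_eq enormL_finite_iff by presburger
qed


section \<open>Convergence along trunks\<close>

definition longest_prefix_in :: "nat list set \<Rightarrow> nat list \<Rightarrow> nat list \<Rightarrow> bool"
  where "longest_prefix_in F t s \<longleftrightarrow>
    prefix s t \<and> s \<in> F \<and> (\<forall>u. prefix u t \<longrightarrow> u \<in> F \<longrightarrow> prefix u s)"

lemma ex_longest_prefix_in: "[] \<in> F \<Longrightarrow> \<exists>s. longest_prefix_in F t s"
proof (induction t rule: rev_induct)
  case Nil
  then show ?case by (auto simp: longest_prefix_in_def)
next
  case (snoc n t)
  show ?case
  proof (cases "t @ [n] \<in> F")
    case True
    then show ?thesis by (auto simp: longest_prefix_in_def)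
  next
    case False
    obtain s where "longest_prefix_in F t s" using snoc by blast
    then have "longest_prefix_in F (t @ [n]) s"
      using False by (auto simp: longest_prefix_in_def)
    then show ?thesis ..
  qed
qed

lemma deltaL_restr_trunk:
  assumes "trunk G" "longest_prefix_in G t u"
  shows "deltaL t (restrL a G) = deltaL u a"
proof -
  have "{s. prefix s t \<and> s \<in> G} = {s. prefix s u}"
    using assms unfolding trunk_def longest_prefix_in_def by (blast intro: prefix_order.trans)
  then show ?thesis unfolding deltaL_restr by (simp add: deltaL_def)
qed

lemma trunk_bounded:
  fixes M :: "nat list \<Rightarrow> nat"
  shows "trunk {s. length s \<le> N \<and> (\<forall>i<length s. s ! i \<le> M (take i s))}" (is "trunk (?F N)")
proof -
  have snoc: "s @ [n] \<in> ?F K \<longleftrightarrow> s \<in> ?F K \<and> length s < K \<and> n \<le> M s" for s n K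
    by (auto simp: nth_append less_Suc_eq)
  have "finite (?F N)"
  proof (induction N)
    case 0
    then show ?case by (simp add: finite_subset[of _ "{[]}"])
  next
    case (Suc N)
    have "s \<in> insert [] (\<Union>s\<in>?F N. (\<lambda>n. s @ [n]) ` {..M s})" if "s \<in> ?F (Suc N)" for s
    proof (cases s rule: rev_exhaust)
      case s: (snoc u n)
      then have "u \<in> ?F N" "n \<le> M u" using that[unfolded s snoc] by auto
      then show ?thesis unfolding s by blast
    qed simp
    then have "?F (Suc N) \<subseteq> insert [] (\<Union>s\<in>?F N. (\<lambda>n. s @ [n]) ` {..M s})" by blast
    moreover have "finite (insert [] (\<Union>s\<in>?F N. (\<lambda>n. s @ [n]) ` {..M s}))"
      using Suc by blast
    ultimately show ?case by (rule finite_subset)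
  qed
  moreover have "s \<in> ?F N" if st: "prefix s t" "t \<in> ?F N" for s t
  proof -
    obtain r where r: "t = s @ r" using st(1) by (auto simp: prefix_def)
    have "s ! i \<le> M (take i s)" if "i < length s" for i
    proof -
      have "i < length t" using that r by simp
      then have "t ! i \<le> M (take i t)" using st(2) by simp
      then show ?thesis using that r by (simp add: nth_append)
    qed
    then show ?thesis using st(2) r by auto
  qed
  moreover have "[] \<in> ?F N" by simp
  ultimately show ?thesis unfolding trunk_def by blast
qed

text \<open>The level condition yields a height \<open>N\<close> past which evaluations barely change, and the cone
  condition a bound \<open>M s\<close> for each node \<open>s\<close> so that they barely change when leaving \<open>s\<close> through
  a successor beyond \<open>M s\<close>. A sequence leaves the trunk of height \<open>N\<close> and branching \<open>M\<close> in one of these two ways.\<close>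

lemma AL_trunk:
  assumes "a \<in> AL" "0 < e"
  shows "\<exists>F. trunk F \<and> (\<forall>t s. longest_prefix_in F t s \<longrightarrow> \<bar>deltaL t a - deltaL s a\<bar> \<le> e)"
proof -
  note AL = iffD1[OF mem_AL_iff assms(1), THEN conjunct2]
  obtain N where N: "\<And>t. \<bar>deltaL t a - deltaL (take N t) a\<bar> \<le> e"
    using AL[THEN conjunct2, rule_format, OF assms(2)] by blast
  have "\<forall>s. \<exists>M. \<forall>n\<ge>M. \<forall>t. prefix (s @ [n]) t \<longrightarrow> \<bar>deltaL t a - deltaL s a\<bar> \<le> e"
    using AL[THEN conjunct1, rule_format, OF assms(2)] by (intro allI)
  then obtain M where M: "\<And>s n t. n \<ge> M s \<Longrightarrow> prefix (s @ [n]) t \<Longrightarrow> \<bar>deltaL t a - deltaL s a\<bar> \<le> e"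
    by metis
  define F where "F = {s. length s \<le> N \<and> (\<forall>i<length s. s ! i \<le> M (take i s))}"
  have "\<bar>deltaL t a - deltaL s a\<bar> \<le> e" if "longest_prefix_in F t s" for t s
  proof -
    have st: "prefix s t" "s \<in> F" and max: "\<And>u. prefix u t \<Longrightarrow> u \<in> F \<Longrightarrow> prefix u s"
      using that by (auto simp: longest_prefix_in_def)
    obtain r where r: "t = s @ r" using st(1) by (auto simp: prefix_def)
    show ?thesis
    proof (cases "length s = N")
      case True
      then show ?thesis using N[of t] r by simp
    next
      case False
      then have len: "length s < N" using st(2) by (simp add: F_def)
      show ?thesis
      proof (cases r)
        case Nil
        then show ?thesis using r assms(2) by simp
      next
        case (Cons m r')
        then have pre: "prefix (s @ [m]) t" using r by simp
        have "s @ [m] \<notin> F" using max[OF pre] by (auto dest: prefix_length_le)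
        then have "\<not> m \<le> M s"
          using st(2) len by (auto simp: F_def nth_append less_Suc_eq)
        then show ?thesis using M[OF _ pre] by simp
      qed
    qed
  qed
  then show ?thesis using trunk_bounded[of N M] unfolding F_def by blast
qed

abbreviation partial_sum :: "(nat list \<Rightarrow> real) \<Rightarrow> nat list set \<Rightarrow> (nat \<Rightarrow> bool) \<Rightarrow>\<^sub>C real"
  where "partial_sum a G \<equiv> (\<Sum>s\<in>G. a s *\<^sub>R chi_cyl (QL s))"

lemma partial_sum_RL:
  assumes "finite G"
  shows "partial_sum a G (RL t) = deltaL t (restrL a G)"
proof -
  have "apply_bcontfun (partial_sum a G) x = (\<Sum>s\<in>G. a s * indicator (cyl (QL s)) x)" for x
    using assms by (induction G) (simp_all add: apply_chi_cyl del: sum_mult_indicator)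
  then have "partial_sum a G (RL t) = (\<Sum>s\<in>G. if prefix s t then a s else 0)"
    by (auto simp: indicator_def RL_in_cyl_QL intro!: sum.cong)
  also have "\<dots> = sum a {s \<in> G. prefix s t}" by (simp add: assms sum.inter_filter)
  also have "\<dots> = deltaL t (restrL a G)" by (simp add: deltaL_restr conj_commute)
  finally show ?thesis .
qed

lemma AL_partial_sum_close:
  assumes "a \<in> AL" "0 < e"
  shows "\<exists>F. trunk F \<and> (\<forall>G t. trunk G \<and> F \<subseteq> G \<longrightarrow> \<bar>partial_sum a G (RL t) - deltaL t a\<bar> \<le> e)"
proof -
  obtain F where F: "trunk F" "\<And>t s. longest_prefix_in F t s \<Longrightarrow> \<bar>deltaL t a - deltaL s a\<bar> \<le> e / 2"
    using AL_trunk[of a "e / 2"] assms by auto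
  have "\<bar>partial_sum a G (RL t) - deltaL t a\<bar> \<le> e" if G: "trunk G" "F \<subseteq> G" for G t
  proof -
    have "[] \<in> F" "[] \<in> G" using F(1) G(1) by (simp_all add: trunk_def)
    then obtain s u where s: "longest_prefix_in F t s" and u: "longest_prefix_in G t u"
      using ex_longest_prefix_in by blast
    \<comment> \<open>\<open>s\<close> lies below \<open>u\<close>, so it is also the longest initial segment of \<open>u\<close> in \<open>F\<close>.\<close>
    have "longest_prefix_in F u s"
      using s u G(2) unfolding longest_prefix_in_def by (meson prefix_order.trans subsetD)
    then have "\<bar>deltaL t a - deltaL s a\<bar> \<le> e / 2" "\<bar>deltaL u a - deltaL s a\<bar> \<le> e / 2"
      using F(2) s by auto
    moreover have "partial_sum a G (RL t) = deltaL u a"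
      using partial_sum_RL[of G] deltaL_restr_trunk[OF G(1) u] G(1) by (simp add: trunk_def)
    ultimately show ?thesis by linarith
  qed
  then show ?thesis using F(1) by blast
qed

lemma AL_trunk_sums:
  assumes "a \<in> AL"
  shows "\<exists>f. (\<lambda>s. a s *\<^sub>R chi_cyl (QL s)) trunk_sums f \<and> (\<forall>t. f (RL t) = deltaL t a)"
proof -
  let ?S = "partial_sum a"
  have "cauchy_filter (filtermap ?S trunks_at_top)"
    unfolding cauchy_filter_metric_filtermap
  proof (intro allI impI)
    fix e :: real assume "0 < e"
    then have "0 < e / 3" by simp
    from AL_partial_sum_close[OF assms this] obtain F where F: "trunk F"
      "\<And>G t. trunk G \<and> F \<subseteq> G \<Longrightarrow> \<bar>?S G (RL t) - deltaL t a\<bar> \<le> e / 3"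
      by blast
    let ?P = "\<lambda>G. trunk G \<and> F \<subseteq> G"
    have "dist (?S G) (?S H) < e" if "?P G" "?P H" for G H
    proof -
      have "norm (?S G - ?S H) \<le> 2 * e / 3"
      proof (rule norm_le_on_RL)
        show "\<bar>(?S G - ?S H) (RL t)\<bar> \<le> 2 * e / 3" for t
          using F(2)[OF that(1), of t] F(2)[OF that(2), of t] unfolding minus_bcontfun.rep_eq by linarith
      qed
      then show ?thesis using \<open>0 < e\<close> by (simp add: dist_norm)
    qed
    moreover have "eventually ?P trunks_at_top"
      unfolding eventually_trunks_at_top using F(1) by blast
    ultimately show "\<exists>P. eventually P trunks_at_top \<and> (\<forall>x y. P x \<and> P y \<longrightarrow> dist (?S x) (?S y) < e)"
      by blast
  qed
  moreover have "filtermap ?S trunks_at_top \<noteq> bot" "filtermap ?S trunks_at_top \<le> principal UNIV"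
    by (simp_all add: filtermap_bot_iff trunks_at_top_neq_bot)
  ultimately obtain f where f: "(?S \<longlongrightarrow> f) trunks_at_top"
    using complete_bcontfun unfolding complete_uniform filterlim_def by blast
  have "f (RL t) = deltaL t a" for t
  proof (rule tendsto_unique[OF trunks_at_top_neq_bot])
    show "((\<lambda>G. ?S G (RL t)) \<longlongrightarrow> f (RL t)) trunks_at_top"
      using tendsto_bcontfun_uniform_limit[OF f] by (rule tendsto_uniform_limitI) simp
    show "((\<lambda>G. ?S G (RL t)) \<longlongrightarrow> deltaL t a) trunks_at_top"
    proof (rule tendstoI)
      fix e :: real assume "0 < e"
      then have e: "0 < e / 2" "e / 2 < e" by simp_all
      from AL_partial_sum_close[OF assms e(1)] obtain F where "trunk F"
        "\<And>G. trunk G \<and> F \<subseteq> G \<Longrightarrow> \<bar>?S G (RL t) - deltaL t a\<bar> \<le> e / 2"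
        by blast
      then show "\<forall>\<^sub>F G in trunks_at_top. dist (?S G (RL t)) (deltaL t a) < e"
        unfolding eventually_trunks_at_top dist_real_def using e(2) by (blast intro: le_less_trans)
    qed
  qed
  with f show ?thesis unfolding trunk_sums_def by blast
qed


section \<open>The operator\<close>

lemma
  assumes "a \<in> AL"
  shows trunk_sums_TL: "(\<lambda>s. a s *\<^sub>R chi_cyl (QL s)) trunk_sums TL a"
    and TL_RL: "TL a (RL t) = deltaL t a"
proof -
  let ?e = "\<lambda>s. a s *\<^sub>R chi_cyl (QL s)"
  obtain f where f: "?e trunk_sums f" "\<forall>t. f (RL t) = deltaL t a"
    using AL_trunk_sums[OF assms] by blast
  have "TL a = f"
    unfolding TL_def trunk_sum_def
    using f(1) by (rule the_equality)
      (use f(1) in \<open>auto simp: trunk_sums_def intro: tendsto_unique[OF trunks_at_top_neq_bot]\<close>)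
  with f show "?e trunk_sums TL a" "TL a (RL t) = deltaL t a" by auto
qed

text \<open>Uniform continuity bounds the increments, since \<open>RL\<close> sends sequences that agree far enough,
  or branch off from \<open>s\<close> with a large entry, to nearby points.\<close>

lemma extends_mem_AL:
  fixes f :: "(nat \<Rightarrow> bool) \<Rightarrow>\<^sub>C real"
  assumes "\<And>t. deltaL t a = f (RL t)"
  shows "a \<in> AL"
  unfolding mem_AL_iff assms
proof (intro conjI allI impI)
  show "\<exists>B. \<forall>t. \<bar>f (RL t)\<bar> \<le> B" using norm_bounded[of f] by auto
next
  fix s and e :: real assume "0 < e"
  then obtain N where N: "\<And>x y. (\<forall>i<N. x i = y i) \<Longrightarrow> \<bar>f x - f y\<bar> < e"
    using Cantor_uniformly_continuous[of e f] by auto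
  have "\<bar>f (RL t) - f (RL s)\<bar> \<le> e" if "N \<le> n" "prefix (s @ [n]) t" for n t
    using that by (intro less_imp_le N allI impI RL_agree_snoc[OF that(2)]) simp
  then show "\<exists>M. \<forall>n\<ge>M. \<forall>t. prefix (s @ [n]) t \<longrightarrow> \<bar>f (RL t) - f (RL s)\<bar> \<le> e" by blast
next
  fix e :: real assume "0 < e"
  then obtain N where N: "\<And>x y. (\<forall>i<N. x i = y i) \<Longrightarrow> \<bar>f x - f y\<bar> < e"
    using Cantor_uniformly_continuous[of e f] by auto
  have "\<bar>f (RL t) - f (RL (take n t))\<bar> \<le> e" if "N \<le> n" for n t
  proof (cases "n \<le> length t")
    case True
    then have "N \<le> length (QL (take n t))" using length_le_QL[of "take n t"] that by simp
    then show ?thesis by (intro less_imp_le N allI impI RL_agree take_is_prefix) simp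
  qed (use \<open>0 < e\<close> in simp)
  then show "\<exists>M. \<forall>n\<ge>M. \<forall>t. \<bar>f (RL t) - f (RL (take n t))\<bar> \<le> e" by blast
qed

lemma TL_eqI: "(\<And>t. deltaL t a = apply_bcontfun f (RL t)) \<Longrightarrow> TL a = f"
  using extends_mem_AL[of a f] by (intro bcontfun_eq_on_RL) (simp add: TL_RL)

lemma subspace_AL: "subspace AL"
proof (rule subspaceI)
  show "0 \<in> AL"
    by (rule extends_mem_AL[of _ 0]) (simp add: deltaL_def)
  show "a + b \<in> AL" if "a \<in> AL" "b \<in> AL" for a b
    by (rule extends_mem_AL[of _ "TL a + TL b"]) (use that in \<open>simp add: deltaL_add TL_RL\<close>)
  show "c *\<^sub>R a \<in> AL" if "a \<in> AL" for a c
    by (rule extends_mem_AL[of _ "c *\<^sub>R TL a"]) (use that in \<open>simp add: deltaL_scale TL_RL\<close>)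
qed

lemma TL_onto: "TL ` AL = UNIV"
proof -
  have "f \<in> TL ` AL" for f
  proof -
    obtain a where a: "\<forall>t. deltaL t a = apply_bcontfun f (RL t)"
      using ex_deltaL[of "\<lambda>t. apply_bcontfun f (RL t)"] by blast
    then show ?thesis using TL_eqI[of a f] extends_mem_AL[of a f] by auto
  qed
  then show ?thesis by blast
qed

lemma inj_on_TL: "inj_on TL AL"
  by (rule inj_onI) (metis TL_RL deltaL_inject)

lemma norm_TL:
  assumes "a \<in> AL"
  shows "norm (TL a) = normL a"
proof -
  have fin: "enormL a < \<infinity>" using assms by (simp add: AL_def)
  have "norm (TL a) \<le> normL a"
    using normL_le_iff[OF fin, of "normL a"] assms
    by (intro norm_le_on_RL) (simp add: TL_RL normL_def)
  moreover have "normL a \<le> norm (TL a)"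
    using normL_le_iff[OF fin, of "norm (TL a)"] norm_bounded[of "TL a" "RL _"] assms
    by (simp add: TL_RL)
  ultimately show ?thesis by simp
qed

lemma leL_iff_leC: "a \<in> AL \<Longrightarrow> b \<in> AL \<Longrightarrow> leL a b \<longleftrightarrow> leC (TL a) (TL b)"
  unfolding leL_def leC_def by (metis TL_RL bcontfun_le_on_RL)

theorem theorem3p24:
  shows "banach_lattice_on AL normL leL
    \<and> (\<forall>a\<in>AL. (\<lambda>s. a s *\<^sub>R chi_cyl (QL s)) trunk_sums TL a)
    \<and> lattice_isometry_onto AL normL leL UNIV norm leC TL
    \<and> embedding_map topL euclidean RL
    \<and> (\<forall>s t. deltaL s (chiL t) = diracC (RL s) (TL (chiL t)))"
proof -
  have add: "TL (a + b) = TL a + TL b" if "a \<in> AL" "b \<in> AL" for a b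
    by (rule TL_eqI) (use that in \<open>simp add: deltaL_add TL_RL\<close>)
  have scale: "TL (c *\<^sub>R a) = c *\<^sub>R TL a" if "a \<in> AL" for a c
    by (rule TL_eqI) (use that in \<open>simp add: deltaL_scale TL_RL\<close>)
  have pullback: "banach_lattice_on AL normL leL" "lattice_isometry_onto AL normL leL UNIV norm leC TL"
    by (rule banach_lattice_pullback[OF banach_lattice_C subspace_AL TL_onto inj_on_TL];
        simp add: add scale norm_TL leL_iff_leC)+
  show ?thesis
    using pullback trunk_sums_TL embedding_RL TL_RL[OF chiL_in_AL] by (simp add: diracC_def)
qed

end
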